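(* For $m\ge1$ let $$\beta_m=\left(A_{1,2}^{-1}A_{2,3}\right)^{-m}A_{3,4}\left(A_{1,2}^{-1}A_{2,3}\right)^m\in P_4.$$ Then the combed normal form of $\beta_m$ is a reduced word in $A_{1,4},A_{2,4},A_{3,4}$ and their inverses, whose length is exponential in $m$ (that is, $\beta_m$ belongs to the free subgroup freely generated by $A_{1,4},A_{2,4},A_{3,4}$, and there are constants $C>0$ and $\lambda>1$ such that for all $m\ge 1$ the reduced word in $A_{1,4}^{\pm1},A_{2,4}^{\pm1},A_{3,4}^{\pm1}$ representing $\beta_m$ has length at least $C\lambda^m$).
   Context: $B_4=\langle\sigma_1,\sigma_2,\sigma_3\mid \sigma_1\sigma_2\sigma_1=\sigma_2\sigma_1\sigma_2,\ \sigma_2\sigma_3\sigma_2=\sigma_3\sigma_2\sigma_3,\ \sigma_1\sigma_3=\sigma_3\sigma_1\rangle$ is the braid group with 4 strands on the disc, and $P_4$ is the pure braid group, the kernel of the natural map $B_4\to\Sigma_4$. It is generated by $A_{i,j}=\sigma_{j-1}\sigma_{j-2}\cdots\sigma_{i+1}\sigma_i^2\sigma_{i+1}^{-1}\cdots\sigma_{j-1}^{-1}$ for $1\le i<j\le4$. For each $k\in\{2,3,4\}$ the elements $\{A_{i,k}\}_{i<k}$ freely generate a free subgroup $F_k$ of $P_4$, and every $\alpha\in P_4$ has a unique decomposition $\alpha=\alpha_2\alpha_3\alpha_4$ with $\alpha_k\in F_k$, called its combed normal form; each $\alpha_k$ is written as a reduced word in the free generators $\{A_{i,k}\}_{i<k}$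 and their inverses. *)

theory Defs
  imports Complex_Main "HOL-Algebra.Sym_Groups" "HOL-Algebra.Generated_Groups"
begin

section \<open>Words in generators and their inverses\<close>

text \<open>The letter \<open>(x, True)\<close> stands for the generator \<open>x\<close>, and \<open>(x, False)\<close> for its
  formal inverse.\<close>

type_synonym 'a gword = "('a \<times> bool) list"

definition words :: "'a set \<Rightarrow> 'a gword set"
  where "words S = lists (S \<times> UNIV)"

definition reduced :: "'a gword \<Rightarrow> bool"
  where "reduced w \<longleftrightarrow> successively (\<lambda>a b. \<not> (fst a = fst b \<and> snd a \<noteq> snd b)) w"

definition reduced_words :: "'a set \<Rightarrow> 'a gword set"
  where "reduced_words S = {w \<in> words S. reduced w}"

fun word_eval :: "('b, 'c) monoid_scheme \<Rightarrow> ('a \<Rightarrow> 'b) \<Rightarrow> 'a gword \<Rightarrow> 'b"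
  where
    "word_eval G f [] = \<one>\<^bsub>G\<^esub>"
  | "word_eval G f ((x, b) # w) = (if b then f x else inv\<^bsub>G\<^esub> (f x)) \<otimes>\<^bsub>G\<^esub> word_eval G f w"

text \<open>The family \<open>(f i)\<close>, \<open>i \<in> I\<close>, freely generates the subgroup \<open>generate G (f ` I)\<close>:
  distinct reduced words have distinct values. (In particular \<open>f\<close> is injective on \<open>I\<close>.)\<close>

definition freely_generates :: "('b, 'c) monoid_scheme \<Rightarrow> ('a \<Rightarrow> 'b) \<Rightarrow> 'a set \<Rightarrow> bool"
  where "freely_generates G f I \<longleftrightarrow>
           f ` I \<subseteq> carrier G \<and> inj_on (word_eval G f) (reduced_words I)"


section \<open>Groups given by a presentation\<close>

text \<open>A relation \<open>u = v\<close> is given as the pair \<open>(u, v)\<close>. The group consists of the classes of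
  words under the congruence generated by the relations and by free cancellation.\<close>

inductive_set pres_rel :: "'a set \<Rightarrow> ('a gword \<times> 'a gword) set \<Rightarrow> ('a gword \<times> 'a gword) set"
  for S R
  where
    refl: "w \<in> words S \<Longrightarrow> (w, w) \<in> pres_rel S R"
  | sym: "(u, v) \<in> pres_rel S R \<Longrightarrow> (v, u) \<in> pres_rel S R"
  | trans: "(u, v) \<in> pres_rel S R \<Longrightarrow> (v, w) \<in> pres_rel S R \<Longrightarrow> (u, w) \<in> pres_rel S R"
  | cancel: "p \<in> words S \<Longrightarrow> s \<in> words S \<Longrightarrow> x \<in> S \<Longrightarrow>
      (p @ [(x, b), (x, \<not> b)] @ s, p @ s) \<in> pres_rel S R"
  | rel: "p \<in> words S \<Longrightarrow> s \<in> words S \<Longrightarrow> u \<in> words S \<Longrightarrow> v \<in> words S \<Longrightarrow> (u, v) \<in> R \<Longrightarrow>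
      (p @ u @ s, p @ v @ s) \<in> pres_rel S R"

definition presented_group :: "'a set \<Rightarrow> ('a gword \<times> 'a gword) set \<Rightarrow> 'a gword set monoid"
  where "presented_group S R =
    \<lparr> carrier = words S // pres_rel S R,
      mult = (\<lambda>X Y. \<Union>u\<in>X. \<Union>v\<in>Y. pres_rel S R `` {u @ v}),
      one = pres_rel S R `` {[]} \<rparr>"

lemma words_append [simp]: "u @ v \<in> words S \<longleftrightarrow> u \<in> words S \<and> v \<in> words S"
  by (auto simp: words_def)

lemma words_Nil [simp]: "[] \<in> words S"
  by (auto simp: words_def)

lemma words_Cons [simp]: "(x, b) # w \<in> words S \<longleftrightarrow> x \<in> S \<and> w \<in> words S"
  by (auto simp: words_def)

lemma pres_rel_words: "(u, v) \<in> pres_rel S R \<Longrightarrow> u \<in> words S \<and> v \<in> words S"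
  by (induction rule: pres_rel.induct) auto

lemma equiv_pres_rel: "equiv (words S) (pres_rel S R)"
proof (rule equivI)
  show "pres_rel S R \<subseteq> words S \<times> words S"
    using pres_rel_words by auto
  show "refl_on (words S) (pres_rel S R)"
    by (auto simp: refl_on_def intro: pres_rel.refl)
  show "sym (pres_rel S R)"
    by (auto simp: sym_on_def intro: pres_rel.sym)
  show "trans (pres_rel S R)"
    by (auto simp: trans_on_def intro: pres_rel.trans)
qed

lemma pres_rel_context:
  assumes "(u, v) \<in> pres_rel S R" "p \<in> words S" "s \<in> words S"
  shows "(p @ u @ s, p @ v @ s) \<in> pres_rel S R"
  using assms
proof (induction rule: pres_rel.induct)
  case (cancel p' s' x b)
  then show ?case using pres_rel.cancel[of "p @ p'" S "s' @ s" x b R] by simp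
next
  case (rel p' s' u v)
  then show ?case using pres_rel.rel[of "p @ p'" S "s' @ s" u v R] by simp
qed (auto intro: pres_rel.intros)

lemma pres_rel_append:
  assumes "(u, u') \<in> pres_rel S R" "(v, v') \<in> pres_rel S R"
  shows "(u @ v, u' @ v') \<in> pres_rel S R"
proof -
  have "(u @ v, u' @ v) \<in> pres_rel S R"
    using pres_rel_context[OF assms(1), of "[]" v] pres_rel_words[OF assms(2)] by simp
  moreover have "(u' @ v, u' @ v') \<in> pres_rel S R"
    using pres_rel_context[OF assms(2), of u' "[]"] pres_rel_words[OF assms(1)] by simp
  ultimately show ?thesis by (rule pres_rel.trans)
qed

lemma presented_group_mult:
  assumes "u \<in> words S" "v \<in> words S"
  shows "(pres_rel S R `` {u}) \<otimes>\<^bsub>presented_group S R\<^esub> (pres_rel S R `` {v})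
           = pres_rel S R `` {u @ v}"
proof -
  have c: "congruent2 (pres_rel S R) (pres_rel S R) (\<lambda>u v. pres_rel S R `` {u @ v})"
    by (intro congruent2I') (auto intro!: equiv_class_eq[OF equiv_pres_rel] pres_rel_append)
  show ?thesis
    using UN_equiv_class2[OF equiv_pres_rel equiv_pres_rel c assms]
    by (simp add: presented_group_def)
qed

lemma pres_rel_inverse:
  assumes "w \<in> words S"
  shows "(map (\<lambda>(x, b). (x, \<not> b)) (rev w) @ w, []) \<in> pres_rel S R"
  using assms
proof (induction w)
  case Nil
  then show ?case by (auto intro: pres_rel.refl)
next
  case (Cons a w)
  obtain x b where a: "a = (x, b)" by (cases a)
  let ?w' = "map (\<lambda>(x, b). (x, \<not> b)) (rev w)"
  have w: "w \<in> words S" "x \<in> S" using Cons.prems a by auto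
  have w': "?w' \<in> words S" using w by (auto simp: words_def)
  have "(?w' @ [(x, \<not> b), (x, \<not> \<not> b)] @ w, ?w' @ w) \<in> pres_rel S R"
    by (rule pres_rel.cancel) (use w w' in auto)
  then show ?case using Cons.IH[OF w(1)] a by (auto intro: pres_rel.trans)
qed

lemma group_presented_group: "group (presented_group S R)"
proof (rule groupI)
  let ?G = "presented_group S R" and ?c = "\<lambda>w. pres_rel S R `` {w}"
  have ex: "\<exists>u \<in> words S. X = ?c u" if "X \<in> carrier ?G" for X
    using that by (auto simp: presented_group_def quotient_def)
  have cl: "?c u \<in> carrier ?G" if "u \<in> words S" for u
    using that by (auto simp: presented_group_def quotient_def)
  have one: "\<one>\<^bsub>?G\<^esub> = ?c []" by (simp add: presented_group_def)
  show "\<one>\<^bsub>?G\<^esub> \<in> carrier ?G" using cl one by simp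
  fix X Y assume X: "X \<in> carrier ?G" 
  obtain u where u: "u \<in> words S" "X = ?c u" using ex X by blast
  show "\<one>\<^bsub>?G\<^esub> \<otimes>\<^bsub>?G\<^esub> X = X"
    using u one by (simp add: presented_group_mult)
  let ?u = "map (\<lambda>(x, b). (x, \<not> b)) (rev u)"
  have "?u \<in> words S" using u by (auto simp: words_def)
  then show "\<exists>Y \<in> carrier ?G. Y \<otimes>\<^bsub>?G\<^esub> X = \<one>\<^bsub>?G\<^esub>"
    using u one cl equiv_class_eq[OF equiv_pres_rel pres_rel_inverse[OF u(1)]]
    by (intro bexI[of _ "?c ?u"]) (auto simp: presented_group_mult)
  assume Y: "Y \<in> carrier ?G"
  obtain v where v: "v \<in> words S" "Y = ?c v" using ex Y by blast
  show "X \<otimes>\<^bsub>?G\<^esub> Y \<in> carrier ?G" using u v cl by (simp add: presented_group_mult)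
  fix Z assume "Z \<in> carrier ?G"
  then obtain w where "w \<in> words S" "Z = ?c w" using ex by blast
  then show "X \<otimes>\<^bsub>?G\<^esub> Y \<otimes>\<^bsub>?G\<^esub> Z = X \<otimes>\<^bsub>?G\<^esub> (Y \<otimes>\<^bsub>?G\<^esub> Z)"
    using u v by (simp add: presented_group_mult)
qed


section \<open>The braid group on four strands and its pure subgroup\<close>

definition B4_relations :: "(nat gword \<times> nat gword) set"
  where "B4_relations =
    {([(1, True), (2, True), (1, True)], [(2, True), (1, True), (2, True)]),
     ([(2, True), (3, True), (2, True)], [(3, True), (2, True), (3, True)]),
     ([(1, True), (3, True)], [(3, True), (1, True)])}"

definition B4 :: "nat gword set monoid"
  where "B4 = presented_group {1, 2, 3} B4_relations"

definition sigma :: "nat \<Rightarrow> nat gword set"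
  where "sigma i = pres_rel {1, 2, 3} B4_relations `` {[(i, True)]}"

text \<open>On the class of a word, the value of the word at the adjacent transpositions;
  this does not depend on the representative, see \<open>braid_perm_class\<close> below.\<close>

definition braid_perm :: "nat gword set \<Rightarrow> (nat \<Rightarrow> nat)"
  where "braid_perm X = the_elem (word_eval (sym_group 4) (\<lambda>i. transpose i (Suc i)) ` X)"

definition P4 :: "nat gword set set"
  where "P4 = kernel B4 (sym_group 4) braid_perm"

definition A :: "nat \<Rightarrow> nat \<Rightarrow> nat gword set"
  where "A i j = word_eval B4 sigma
    (map (\<lambda>k. (k, True)) (rev [Suc i..<j]) @ [(i, True), (i, True)] @
     map (\<lambda>k. (k, False)) [Suc i..<j])"

definition F :: "nat \<Rightarrow> nat gword set set"
  where "F k = generate B4 ((\<lambda>i. A i k) ` {1..<k})"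

text \<open>In a word for an element of \<open>F k\<close>, the letter \<open>i\<close> stands for \<open>A i k\<close>.\<close>

definition is_combed_normal_form ::
    "nat gword set \<Rightarrow> nat gword \<times> nat gword \<times> nat gword \<Rightarrow> bool"
  where "is_combed_normal_form \<alpha> = (\<lambda>(w\<^sub>2, w\<^sub>3, w\<^sub>4).
    \<alpha> \<in> P4 \<and>
    w\<^sub>2 \<in> reduced_words {1..<2} \<and> w\<^sub>3 \<in> reduced_words {1..<3} \<and> w\<^sub>4 \<in> reduced_words {1..<4} \<and>
    \<alpha> = word_eval B4 (\<lambda>i. A i 2) w\<^sub>2 \<otimes>\<^bsub>B4\<^esub> word_eval B4 (\<lambda>i. A i 3) w\<^sub>3
          \<otimes>\<^bsub>B4\<^esub> word_eval B4 (\<lambda>i. A i 4) w\<^sub>4)"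

definition \<beta> :: "nat \<Rightarrow> nat gword set"
  where "\<beta> m = ((inv\<^bsub>B4\<^esub> A 1 2) \<otimes>\<^bsub>B4\<^esub> A 2 3) [^]\<^bsub>B4\<^esub> (- int m) \<otimes>\<^bsub>B4\<^esub> A 3 4
                 \<otimes>\<^bsub>B4\<^esub> ((inv\<^bsub>B4\<^esub> A 1 2) \<otimes>\<^bsub>B4\<^esub> A 2 3) [^]\<^bsub>B4\<^esub> (int m)"


lemma group_B4: "group B4"
  unfolding B4_def by (rule group_presented_group)

lemma (in group) word_eval_closed:
  "f ` S \<subseteq> carrier G \<Longrightarrow> w \<in> words S \<Longrightarrow> word_eval G f w \<in> carrier G"
  by (induction w) (auto simp: image_subset_iff)

lemma (in group) word_eval_append:
  "f ` S \<subseteq> carrier G \<Longrightarrow> u \<in> words S \<Longrightarrow> v \<in> words S \<Longrightarrow>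
    word_eval G f (u @ v) = word_eval G f u \<otimes> word_eval G f v"
  by (induction u) (auto simp: m_assoc word_eval_closed image_subset_iff)

lemma (in group) word_eval_pres_rel:
  assumes f: "f ` S \<subseteq> carrier G"
    and R: "\<And>u v. (u, v) \<in> R \<Longrightarrow> word_eval G f u = word_eval G f v"
    and uv: "(u, v) \<in> pres_rel S R"
  shows "word_eval G f u = word_eval G f v"
  using uv
proof (induction rule: pres_rel.induct)
  case (cancel p s x b)
  have x: "f x \<in> carrier G" using f cancel by auto
  have s: "word_eval G f s \<in> carrier G" using word_eval_closed f cancel by blast
  have "word_eval G f ([(x, b), (x, \<not> b)] @ s) = word_eval G f s"
    using x s by (cases b) (auto simp: m_assoc[symmetric])
  moreover have "[(x, b), (x, \<not> b)] @ s \<in> words S" using cancel by auto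
  ultimately show ?case using word_eval_append[OF f] cancel by metis
next
  case (rel p s u v)
  then show ?case using R by (auto simp: word_eval_append[OF f])
qed auto

lemma transpose_braid:
  "transpose a (Suc a) \<circ> (transpose (Suc a) (Suc (Suc a)) \<circ> transpose a (Suc a))
     = transpose (Suc a) (Suc (Suc a)) \<circ> (transpose a (Suc a) \<circ> transpose (Suc a) (Suc (Suc a)))"
  by (simp add: fun_eq_iff transpose_def)

lemma transpose_commute_1_3:
  "transpose 1 2 \<circ> transpose 3 4 = transpose 3 4 \<circ> transpose 1 (2::nat)"
  by (simp add: fun_eq_iff transpose_def)

lemma image_eq_singleton:
  assumes "a \<in> X" "\<And>x. x \<in> X \<Longrightarrow> f x = f a"
  shows "f ` X = {f a}"
  using assms by blast

lemma braid_perm_class: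
  assumes "w \<in> words {1, 2, 3}"
  shows "braid_perm (pres_rel {1, 2, 3} B4_relations `` {w})
           = word_eval (sym_group 4) (\<lambda>i. transpose i (Suc i)) w"
proof -
  interpret group "sym_group 4" by (rule sym_group_is_group)
  let ?e = "word_eval (sym_group 4) (\<lambda>i. transpose i (Suc i))"
  have f: "(\<lambda>i. transpose i (Suc i)) ` {1, 2, 3} \<subseteq> carrier (sym_group 4)"
  proof (rule image_subsetI)
    fix i :: nat
    assume "i \<in> {1, 2, 3}"
    then have "i \<in> {1..4}" "Suc i \<in> {1..4}" by auto
    then show "transpose i (Suc i) \<in> carrier (sym_group 4)"
      unfolding sym_group_carrier by (rule permutes_swap_id)
  qed
  have R: "?e u = ?e v" if uv: "(u, v) \<in> B4_relations" for u v
  proof -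
    have Suc: "Suc 1 = 2" "Suc 2 = 3" "Suc 3 = 4" by simp_all
    consider "u = [(1, True), (2, True), (1, True)]" "v = [(2, True), (1, True), (2, True)]"
      | "u = [(2, True), (3, True), (2, True)]" "v = [(3, True), (2, True), (3, True)]"
      | "u = [(1, True), (3, True)]" "v = [(3, True), (1, True)]"
      using uv unfolding B4_relations_def by (simp only: insert_iff empty_iff prod.inject simp_thms) blast
    then show ?thesis
      by cases (simp_all only: word_eval.simps if_True sym_group_mult sym_group_one comp_id Suc
          transpose_braid[of 1, unfolded Suc] transpose_braid[of 2, unfolded Suc] transpose_commute_1_3)
  qed
  have eq: "?e v = ?e w" if "v \<in> pres_rel {1, 2, 3} B4_relations `` {w}" for v
  proof -
    have "(w, v) \<in> pres_rel {1, 2, 3} B4_relations" using that by simp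
    from word_eval_pres_rel[OF f R this] show ?thesis by (rule HOL.sym)
  qed
  have "w \<in> pres_rel {1, 2, 3} B4_relations `` {w}"
    using pres_rel.refl[OF assms] by simp
  then have "?e ` (pres_rel {1, 2, 3} B4_relations `` {w}) = {?e w}"
    by (rule image_eq_singleton) (rule eq)
  then show ?thesis by (simp only: braid_perm_def the_elem_eq)
qed

end

theory Submission
  imports Defs "HOL-Algebra.Bij"
begin

text \<open>
  The braid group acts on quadruples of elements of any rack (the Hurwitz action):
  \<open>sigma i\<close> sends neighbours \<open>(a, b)\<close> in places \<open>i\<close>, \<open>i + 1\<close> to \<open>(a \<triangleright> b, a)\<close>, and the braid
  relation is the self-distributive law. Take the rack that consists of the permutations of a
  set \<open>X\<close>, acting on each other by conjugation, and of the points of \<open>X\<close>, on which permutations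
  act by evaluation while points act trivially. On a quadruple \<open>(x\<^sub>1, x\<^sub>2, x\<^sub>3, p)\<close> with a point
  \<open>p\<close>, the braid \<open>A i 4\<close> carries the last strand once around strand \<open>i\<close>; it fixes the three
  permutations and replaces \<open>p\<close> by \<open>x\<^sub>i p\<close>. So a word in the \<open>A i 4\<close> acts on \<open>p\<close> as the same word
  in the \<open>x\<^sub>i\<close>. In the same way, words in the \<open>A i 3\<close> are seen on quadruples
  \<open>(x\<^sub>1, x\<^sub>2, p, q)\<close> with two points, and powers of \<open>A 1 2\<close> on \<open>(x\<^sub>1, p, q, r)\<close>.

  Two choices of \<open>X\<close> give the theorem. First let \<open>X\<close> be the set of reduced words and let \<open>x\<^sub>i\<close>
  put the letter \<open>i\<close> in front and cancel. A reduced word then carries the empty word to itself, hence can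
  be recovered from the braid. This gives freeness (\<open>freely_generates_A4\<close>) and uniqueness of the
  combed normal form of elements of \<open>F 4\<close> (\<open>combed_normal_form_unique\<close>). The braid \<open>\<beta> m\<close> lies in
  \<open>F 4\<close> because conjugation by \<open>\<sigma>\<^sub>1\<close> and by \<open>\<sigma>\<^sub>2\<^sup>-\<^sup>1\<close> maps \<open>F 4\<close> to itself
  (\<open>F4_conjugation\<close>).

  Secondly let \<open>X\<close> be the integers and let \<open>x\<^sub>1, x\<^sub>2, x\<^sub>3\<close> be the reflections in \<open>0, 0, 1\<close>. A word
  with \<open>n\<close> letters moves the point \<open>0\<close> by at most \<open>2 * n\<close> (\<open>carry_reflect_bound\<close>). On
  the other hand, the braid \<open>conjugator = A\<^sub>1\<^sub>2\<^sup>-\<^sup>1 A\<^sub>2\<^sub>3\<close> acts linearly on the centres of the three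
  reflections, and the distance between the last two grows at least by the factor \<open>5\<close> in each
  step. As \<open>\<beta> m\<close> conjugates \<open>A 3 4\<close> by the \<open>m\<close>-th power of this braid, it moves \<open>0\<close> to twice the
  third of the resulting centres, which has exponential size (\<open>\<beta>_action\<close>). Comparing the two
  estimates shows that the word for \<open>\<beta> m\<close> is exponentially long.
\<close>

section \<open>Homomorphisms out of a presented group\<close>

text \<open>Von Dyck's theorem: a map on generators whose word values do not depend on the
  representative is a homomorphism.\<close>

lemma group_hom_presented_group:
  assumes G: "group G" and f: "f ` S \<subseteq> carrier G"
    and h: "\<And>w. w \<in> words S \<Longrightarrow> h (pres_rel S R `` {w}) = word_eval G f w"
  shows "group_hom (presented_group S R) G h"
proof -
  interpret G: group G by (rule G)
  have ex: "\<exists>u \<in> words S. X = pres_rel S R `` {u}" if "X \<in> carrier (presented_group S R)" for X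
    using that by (auto simp: presented_group_def quotient_def)
  have "h \<in> hom (presented_group S R) G"
  proof (rule homI)
    fix X assume "X \<in> carrier (presented_group S R)"
    then show "h X \<in> carrier G" using ex h G.word_eval_closed[OF f] by metis
  next
    fix X Y
    assume "X \<in> carrier (presented_group S R)" "Y \<in> carrier (presented_group S R)"
    then obtain u v where "u \<in> words S" "v \<in> words S"
      "X = pres_rel S R `` {u}" "Y = pres_rel S R `` {v}" using ex by metis
    then show "h (X \<otimes>\<^bsub>presented_group S R\<^esub> Y) = h X \<otimes>\<^bsub>G\<^esub> h Y"
      by (simp add: presented_group_mult h G.word_eval_append[OF f])
  qed
  then show ?thesis
    by (simp add: group_hom_def group_hom_axioms_def group_presented_group G)
qed

interpretation B4: group B4
  by (rule group_B4)

lemma sigma_closed [simp]: "i \<in> {1, 2, 3} \<Longrightarrow> sigma i \<in> carrier B4"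
  by (auto simp: sigma_def B4_def presented_group_def quotient_def)

lemma sigma_closed_each [simp]:
  "sigma (Suc 0) \<in> carrier B4" "sigma 2 \<in> carrier B4" "sigma 3 \<in> carrier B4"
  by simp_all

lemma sigma_braid_12:
  "sigma 1 \<otimes>\<^bsub>B4\<^esub> (sigma 2 \<otimes>\<^bsub>B4\<^esub> sigma 1) = sigma 2 \<otimes>\<^bsub>B4\<^esub> (sigma 1 \<otimes>\<^bsub>B4\<^esub> sigma 2)"
  and sigma_braid_23:
  "sigma 2 \<otimes>\<^bsub>B4\<^esub> (sigma 3 \<otimes>\<^bsub>B4\<^esub> sigma 2) = sigma 3 \<otimes>\<^bsub>B4\<^esub> (sigma 2 \<otimes>\<^bsub>B4\<^esub> sigma 3)"
  and sigma_commute_13: "sigma 1 \<otimes>\<^bsub>B4\<^esub> sigma 3 = sigma 3 \<otimes>\<^bsub>B4\<^esub> sigma 1"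
proof -
  have r: "(u, v) \<in> B4_relations \<Longrightarrow> u \<in> words {1, 2, 3} \<Longrightarrow> v \<in> words {1, 2, 3} \<Longrightarrow>
    pres_rel {1, 2, 3} B4_relations `` {u} = pres_rel {1, 2, 3} B4_relations `` {v}" for u v
    by (rule equiv_class_eq[OF equiv_pres_rel])
      (use pres_rel.rel[of "[]" "{1, 2, 3}" "[]" u v B4_relations] in simp)
  show "sigma 1 \<otimes>\<^bsub>B4\<^esub> (sigma 2 \<otimes>\<^bsub>B4\<^esub> sigma 1) = sigma 2 \<otimes>\<^bsub>B4\<^esub> (sigma 1 \<otimes>\<^bsub>B4\<^esub> sigma 2)"
    "sigma 2 \<otimes>\<^bsub>B4\<^esub> (sigma 3 \<otimes>\<^bsub>B4\<^esub> sigma 2) = sigma 3 \<otimes>\<^bsub>B4\<^esub> (sigma 2 \<otimes>\<^bsub>B4\<^esub> sigma 3)"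
    "sigma 1 \<otimes>\<^bsub>B4\<^esub> sigma 3 = sigma 3 \<otimes>\<^bsub>B4\<^esub> sigma 1"
    by (simp_all add: sigma_def B4_def presented_group_mult)
      (rule r[unfolded One_nat_def]; simp add: B4_relations_def)+
qed

lemma A_as_products:
  "A 1 2 = sigma 1 \<otimes>\<^bsub>B4\<^esub> sigma 1"
  "A 2 3 = sigma 2 \<otimes>\<^bsub>B4\<^esub> sigma 2"
  "A 3 4 = sigma 3 \<otimes>\<^bsub>B4\<^esub> sigma 3"
  "A 1 3 = sigma 2 \<otimes>\<^bsub>B4\<^esub> (sigma 1 \<otimes>\<^bsub>B4\<^esub> (sigma 1 \<otimes>\<^bsub>B4\<^esub> inv\<^bsub>B4\<^esub> sigma 2))"
  "A 2 4 = sigma 3 \<otimes>\<^bsub>B4\<^esub> (sigma 2 \<otimes>\<^bsub>B4\<^esub> (sigma 2 \<otimes>\<^bsub>B4\<^esub> inv\<^bsub>B4\<^esub> sigma 3))"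
  "A 1 4 = sigma 3 \<otimes>\<^bsub>B4\<^esub> (sigma 2 \<otimes>\<^bsub>B4\<^esub> (sigma 1 \<otimes>\<^bsub>B4\<^esub> (sigma 1 \<otimes>\<^bsub>B4\<^esub>
             (inv\<^bsub>B4\<^esub> sigma 2 \<otimes>\<^bsub>B4\<^esub> inv\<^bsub>B4\<^esub> sigma 3))))"
  by (simp_all add: A_def upt_rec numeral_2_eq_2 numeral_3_eq_3)

lemmas A_products = A_as_products A_as_products[unfolded One_nat_def]

lemma A_closed:
  "A 1 2 \<in> carrier B4" "A 1 3 \<in> carrier B4" "A 2 3 \<in> carrier B4"
  "A 1 4 \<in> carrier B4" "A 2 4 \<in> carrier B4" "A 3 4 \<in> carrier B4"
  by (simp_all only: A_as_products B4.m_closed B4.inv_closed sigma_closed insert_iff simp_thms)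

lemma A_family_closed:
  "(\<lambda>i. A i 2) ` {1..<2} \<subseteq> carrier B4"
  "(\<lambda>i. A i 3) ` {1..<3} \<subseteq> carrier B4"
  "(\<lambda>i. A i 4) ` {1..<4} \<subseteq> carrier B4"
proof -
  have "{1..<2} = {1::nat}" "{1..<3} = {1, 2::nat}" "{1..<4} = {1, 2, 3::nat}" by auto
  then show
    "(\<lambda>i. A i 2) ` {1..<2} \<subseteq> carrier B4"
    "(\<lambda>i. A i 3) ` {1..<3} \<subseteq> carrier B4"
    "(\<lambda>i. A i 4) ` {1..<4} \<subseteq> carrier B4"
    by (simp_all only: image_insert image_empty insert_subset empty_subsetI A_closed simp_thms)
qed

section \<open>Free reduction\<close>

text \<open>Left multiplication by a letter in the free group of reduced words. Words that are not
  reduced are left alone, which makes it a permutation of the whole type.\<close>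

definition push :: "'a \<times> bool \<Rightarrow> 'a gword \<Rightarrow> 'a gword"
  where "push l w = (if \<not> reduced w then w else
    (case w of [] \<Rightarrow> [l]
       | k # v \<Rightarrow> if fst k = fst l \<and> snd k \<noteq> snd l then v else l # w))"

lemma reduced_Nil [simp]: "reduced []"
  by (simp add: reduced_def)

lemma reduced_Cons:
  "reduced (l # w) \<longleftrightarrow>
     reduced w \<and> (w = [] \<or> \<not> (fst l = fst (hd w) \<and> snd l \<noteq> snd (hd w)))"
  by (cases w) (auto simp: reduced_def)

lemma reduced_push: "reduced w \<Longrightarrow> reduced (push l w)"
  by (auto simp: push_def reduced_Cons split: list.split)

lemma push_words: "w \<in> words S \<Longrightarrow> fst l \<in> S \<Longrightarrow> push l w \<in> words S"
  by (cases l) (auto simp: push_def words_def split: list.split)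

lemma push_reduced_Cons: "reduced (l # w) \<Longrightarrow> push l w = l # w"
  by (auto simp: push_def reduced_Cons split: list.split)

lemma push_push_inverse: "push (x, \<not> b) (push (x, b) w) = w"
proof (cases "reduced w \<and> (\<exists>v. w = (x, \<not> b) # v)")
  case True
  then obtain v where v: "w = (x, \<not> b) # v" and red: "reduced w" by blast
  then have "push (x, b) w = v" by (simp add: push_def)
  then show ?thesis using push_reduced_Cons red v by metis
next
  case False
  show ?thesis
  proof (cases "reduced w")
    case True
    then have "push (x, b) w = (x, b) # w" "reduced ((x, b) # w)"
      using False by (cases w; force simp: push_def reduced_Cons)+
    then show ?thesis by (simp add: push_def)
  qed (simp add: push_def)
qed

lemma bij_push: "bij (push (x, b))"
  by (rule o_bij[of "push (x, \<not> b)"])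
    (use push_push_inverse[of x b] push_push_inverse[of x "\<not> b"] in \<open>auto simp: fun_eq_iff\<close>)

lemma inv_push: "inv_into UNIV (push (x, b)) = push (x, \<not> b)"
  by (rule inv_unique_comp)
    (use push_push_inverse[of x b] push_push_inverse[of x "\<not> b"] in \<open>auto simp: fun_eq_iff\<close>)

lemma (in group) word_eval_push:
  assumes f: "f ` S \<subseteq> carrier G" and w: "w \<in> words S" "reduced w" and x: "x \<in> S"
  shows "word_eval G f (push (x, b) w) = word_eval G f ((x, b) # w)"
proof (cases "\<exists>v. w = (x, \<not> b) # v")
  case True
  then obtain v where v: "w = (x, \<not> b) # v" by blast
  then have "word_eval G f v \<in> carrier G" "f x \<in> carrier G"
    using word_eval_closed[OF f] w f x by auto
  then show ?thesis using v w by (cases b) (simp_all add: push_def m_assoc[symmetric])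
next
  case False
  then have "push (x, b) w = (x, b) # w"
    using w by (cases w) (auto simp: push_def)
  then show ?thesis by simp
qed

lemma (in group) reduced_word_of_word:
  assumes f: "f ` S \<subseteq> carrier G" and w: "w \<in> words S"
  shows "\<exists>v \<in> reduced_words S. word_eval G f v = word_eval G f w"
  using w
proof (induction w)
  case Nil
  then show ?case by (intro bexI[of _ "[]"]) (auto simp: reduced_words_def)
next
  case (Cons l w)
  obtain x b where l: "l = (x, b)" by (cases l)
  obtain v where v: "v \<in> reduced_words S" "word_eval G f v = word_eval G f w"
    using Cons l by auto
  have "push l v \<in> reduced_words S"
    using v Cons.prems l by (auto simp: reduced_words_def reduced_push push_words)
  moreover have "word_eval G f (push l v) = word_eval G f (l # w)"
    using v Cons.prems l by (auto simp: reduced_words_def word_eval_push[OF f])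
  ultimately show ?case by blast
qed

lemma (in group) reduced_word_of_generate:
  assumes f: "f ` S \<subseteq> carrier G" and g: "g \<in> generate G (f ` S)"
  shows "\<exists>w \<in> reduced_words S. word_eval G f w = g"
proof -
  have "\<exists>w \<in> words S. word_eval G f w = g"
    using g
  proof (induction rule: generate.induct)
    case one
    then show ?case by (intro bexI[of _ "[]"]) auto
  next
    case (incl h)
    then obtain x where "x \<in> S" "h = f x" by blast
    then show ?case using f by (intro bexI[of _ "[(x, True)]"]) auto
  next
    case (inv h)
    then obtain x where "x \<in> S" "h = f x" by blast
    then show ?case using f by (intro bexI[of _ "[(x, False)]"]) auto
  next
    case (eng h1 h2)
    then obtain u v where "u \<in> words S" "word_eval G f u = h1" "v \<in> words S" "word_eval G f v = h2"
      by blast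
    then show ?case by (intro bexI[of _ "u @ v"]) (auto simp: word_eval_append[OF f])
  qed
  then show ?thesis using reduced_word_of_word[OF f] by metis
qed

section \<open>The braid action on quadruples of elements of a rack\<close>

text \<open>A rack has bijective left translations \<open>a \<triangleright> _\<close>, with inverses \<open>a \<triangleright>\<^sup>- _\<close>, which are
  automorphisms of the operation.\<close>

locale rack =
  fixes tri :: "'r \<Rightarrow> 'r \<Rightarrow> 'r"  (infixr \<open>\<triangleright>\<close> 70)
    and itri :: "'r \<Rightarrow> 'r \<Rightarrow> 'r"  (infixr \<open>\<triangleright>\<^sup>-\<close> 70)
  assumes itri_tri [simp]: "a \<triangleright>\<^sup>- (a \<triangleright> b) = b"
    and tri_itri [simp]: "a \<triangleright> (a \<triangleright>\<^sup>- b) = b"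
    and self_distrib: "a \<triangleright> (b \<triangleright> c) = (a \<triangleright> b) \<triangleright> (a \<triangleright> c)"
begin

text \<open>The Hurwitz moves: the element \<open>a\<close> passes over its right neighbour \<open>b\<close> and acts on it.\<close>

definition twist :: "nat \<Rightarrow> 'r \<times> 'r \<times> 'r \<times> 'r \<Rightarrow> 'r \<times> 'r \<times> 'r \<times> 'r"
  where "twist i = (\<lambda>(a, b, c, d).
    if i = 1 then (a \<triangleright> b, a, c, d)
    else if i = 2 then (a, b \<triangleright> c, b, d)
    else (a, b, c \<triangleright> d, c))"

definition untwist :: "nat \<Rightarrow> 'r \<times> 'r \<times> 'r \<times> 'r \<Rightarrow> 'r \<times> 'r \<times> 'r \<times> 'r"
  where "untwist i = (\<lambda>(a, b, c, d).
    if i = 1 then (b, b \<triangleright>\<^sup>- a, c, d)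
    else if i = 2 then (a, c, c \<triangleright>\<^sup>- b, d)
    else (a, b, d, d \<triangleright>\<^sup>- c))"

lemma twist_untwist: "twist i (untwist i s) = s"
  by (auto simp: twist_def untwist_def split: prod.split)

lemma untwist_twist: "untwist i (twist i s) = s"
  by (auto simp: twist_def untwist_def split: prod.split)

lemma twist_in_Bij: "twist i \<in> carrier (BijGroup UNIV)"
  using o_bij[of "untwist i" "twist i"]
  by (auto simp: BijGroup_def Bij_def fun_eq_iff twist_untwist untwist_twist)

lemma twist_braid:
  "twist 1 (twist 2 (twist 1 s)) = twist 2 (twist 1 (twist 2 s))"
  "twist 2 (twist 3 (twist 2 s)) = twist 3 (twist 2 (twist 3 s))"
  "twist 1 (twist 3 s) = twist 3 (twist 1 s)"
  by (simp_all add: twist_def self_distrib[symmetric] split: prod.split)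

text \<open>A class of words acts as any of its members does. Words are evaluated with composition as
  the product, so that the last letter of a word acts first.\<close>

definition braid_action :: "nat gword set \<Rightarrow> 'r \<times> 'r \<times> 'r \<times> 'r \<Rightarrow> 'r \<times> 'r \<times> 'r \<times> 'r"
  where "braid_action X = word_eval (BijGroup UNIV) twist (SOME w. w \<in> X)"

lemma BijGroup_mult_apply:
  "f \<in> carrier (BijGroup UNIV) \<Longrightarrow> g \<in> carrier (BijGroup UNIV) \<Longrightarrow>
    (f \<otimes>\<^bsub>BijGroup UNIV\<^esub> g) s = f (g s)"
  by (simp add: BijGroup_def compose_def)

lemma braid_action_class:
  assumes w: "w \<in> words {1, 2, 3}"
  shows "braid_action (pres_rel {1, 2, 3} B4_relations `` {w}) = word_eval (BijGroup UNIV) twist w"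
proof -
  interpret Bij: group "BijGroup (UNIV :: ('r \<times> 'r \<times> 'r \<times> 'r) set)" by (rule group_BijGroup)
  let ?X = "pres_rel {1, 2, 3} B4_relations `` {w}"
  have f: "twist ` {1, 2, 3} \<subseteq> carrier (BijGroup UNIV)" using twist_in_Bij by auto
  have R: "word_eval (BijGroup UNIV) twist u = word_eval (BijGroup UNIV) twist v"
    if "(u, v) \<in> B4_relations" for u v
    using that unfolding B4_relations_def
    by (auto simp: fun_eq_iff BijGroup_mult_apply twist_in_Bij twist_braid[unfolded One_nat_def])
  have "w \<in> ?X" using pres_rel.refl[OF w] by simp
  then have "(SOME u. u \<in> ?X) \<in> ?X" by (rule someI)
  then have "(w, SOME u. u \<in> ?X) \<in> pres_rel {1, 2, 3} B4_relations" by simp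
  then show ?thesis
    unfolding braid_action_def using Bij.word_eval_pres_rel[OF f R] by metis
qed

lemma group_hom_braid_action: "group_hom B4 (BijGroup UNIV) braid_action"
  unfolding B4_def
  by (rule group_hom_presented_group[where f = twist])
    (use twist_in_Bij group_BijGroup braid_action_class in auto)

lemma action_mult [simp]:
  "X \<in> carrier B4 \<Longrightarrow> Y \<in> carrier B4 \<Longrightarrow>
    braid_action (X \<otimes>\<^bsub>B4\<^esub> Y) s = braid_action X (braid_action Y s)"
  using group_hom_braid_action
  by (simp add: group_hom.hom_mult group_hom.hom_closed BijGroup_mult_apply)

lemma action_one [simp]: "braid_action \<one>\<^bsub>B4\<^esub> s = s"
  using group_hom.hom_one[OF group_hom_braid_action] by (simp add: BijGroup_def)

lemma action_inv_action [simp]: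
  "X \<in> carrier B4 \<Longrightarrow> braid_action (inv\<^bsub>B4\<^esub> X) (braid_action X s) = s"
  by (simp flip: action_mult)

lemma action_sigma: "i \<in> {1, 2, 3} \<Longrightarrow> braid_action (sigma i) s = twist i s"
proof -
  assume "i \<in> {1, 2, 3}"
  then have "braid_action (sigma i) = twist i \<otimes>\<^bsub>BijGroup UNIV\<^esub> \<one>\<^bsub>BijGroup UNIV\<^esub>"
    using braid_action_class[of "[(i, True)]"] by (simp add: sigma_def)
  then show ?thesis
    using monoid.r_one[OF group.is_monoid[OF group_BijGroup] twist_in_Bij] by metis
qed

lemma action_inv_sigma: "i \<in> {1, 2, 3} \<Longrightarrow> braid_action (inv\<^bsub>B4\<^esub> sigma i) s = untwist i s"
  using action_inv_action[of "sigma i" "untwist i s"] by (simp add: action_sigma twist_untwist)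

text \<open>A strand with an inert label passes over the others without changing their labels. Only
  such labels are put on the moving strand below.\<close>

definition inert :: "'r \<Rightarrow> bool"
  where "inert p \<longleftrightarrow> (\<forall>a. p \<triangleright> a = a)"

lemma inert_itri: "inert p \<Longrightarrow> p \<triangleright>\<^sup>- a = a"
  unfolding inert_def by (metis itri_tri)

lemma inert_tri: "inert p \<Longrightarrow> inert (a \<triangleright> p)"
  unfolding inert_def by (metis self_distrib tri_itri)

lemma inert_itri_point: "inert p \<Longrightarrow> inert (a \<triangleright>\<^sup>- p)"
  unfolding inert_def by (metis self_distrib tri_itri itri_tri)

text \<open>The effect of a word on \<open>p\<close> when letter \<open>i\<close> stands for the translation by \<open>x i\<close>.\<close>

fun carry :: "(nat \<Rightarrow> 'r) \<Rightarrow> nat gword \<Rightarrow> 'r \<Rightarrow> 'r"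
  where
    "carry x [] p = p"
  | "carry x ((i, b) # w) p = (if b then x i \<triangleright> carry x w p else x i \<triangleright>\<^sup>- carry x w p)"

lemma inert_carry: "inert p \<Longrightarrow> inert (carry x w p)"
  by (induction x w p rule: carry.induct) (auto simp: inert_tri inert_itri_point)

text \<open>The embedding \<open>e\<close> puts a label on the moving strand of an otherwise fixed quadruple. It is
  enough to know the action of the generators: an inverse generator undoes the translation by
  applying the hypothesis to \<open>x i \<triangleright>\<^sup>- q\<close>, and all labels that occur remain inert.\<close>

lemma action_word:
  assumes f: "f ` S \<subseteq> carrier B4" and w: "w \<in> words S" and p: "inert p"
    and step: "\<And>i q. i \<in> S \<Longrightarrow> inert q \<Longrightarrow> braid_action (f i) (e q) = e (x i \<triangleright> q)"
  shows "braid_action (word_eval B4 f w) (e p) = e (carry x w p)"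
  using w
proof (induction w)
  case (Cons l w)
  obtain i b where l: "l = (i, b)" by (cases l)
  have i: "i \<in> S" "f i \<in> carrier B4" and w: "w \<in> words S" using Cons.prems l f by auto
  note q = inert_carry[OF p, of x w]
  have "braid_action (inv\<^bsub>B4\<^esub> f i) (e (carry x w p)) = e (x i \<triangleright>\<^sup>- carry x w p)"
    using action_inv_action[OF i(2), of "e (x i \<triangleright>\<^sup>- carry x w p)"]
      step[OF i(1) inert_itri_point[OF q]] by simp
  then show ?case
    using Cons.IH[OF w] l i step[OF i(1) q] B4.word_eval_closed[OF f w] by simp
qed simp

text \<open>To apply \<open>A i 4\<close>, the inert label \<open>q\<close> first moves to the place next to \<open>x i\<close> without changing
  anything, then the two twists with \<open>x i\<close> replace it by \<open>x i \<triangleright> q\<close>, and finally it returns,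
  again acting trivially on the labels that it passes.\<close>

lemma action_word_A4:
  assumes "w \<in> words {1..<4}" "inert p"
  shows "braid_action (word_eval B4 (\<lambda>i. A i 4) w) (x 1, x 2, x 3, p)
           = (x 1, x 2, x 3, carry x w p)"
proof (rule action_word[OF A_family_closed(3) assms, where e = "\<lambda>q. (x 1, x 2, x 3, q)"])
  fix i q assume "i \<in> {1..<4::nat}" "inert q"
  then have "i = 1 \<or> i = 2 \<or> i = 3" by auto
  then show "braid_action (A i 4) (x 1, x 2, x 3, q) = (x 1, x 2, x 3, x i \<triangleright> q)"
    using \<open>inert q\<close> inert_tri[OF \<open>inert q\<close>, unfolded inert_def]
    by (elim disjE) (simp_all add: A_products
      action_sigma action_inv_sigma twist_def untwist_def
      inert_itri inert_def)
qed

lemma action_word_A3: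
  assumes "w \<in> words {1..<3}" "inert p"
  shows "braid_action (word_eval B4 (\<lambda>i. A i 3) w) (x 1, x 2, p, r)
           = (x 1, x 2, carry x w p, r)"
proof (rule action_word[OF A_family_closed(2) assms, where e = "\<lambda>q. (x 1, x 2, q, r)"])
  fix i q assume "i \<in> {1..<3::nat}" "inert q"
  then have "i = 1 \<or> i = 2" by auto
  then show "braid_action (A i 3) (x 1, x 2, q, r) = (x 1, x 2, x i \<triangleright> q, r)"
    using \<open>inert q\<close> inert_tri[OF \<open>inert q\<close>, unfolded inert_def]
    by (elim disjE) (simp_all add: A_products
      action_sigma action_inv_sigma twist_def untwist_def
      inert_itri inert_def)
qed

lemma action_word_A2:
  assumes "w \<in> words {1..<2}" "inert p"
  shows "braid_action (word_eval B4 (\<lambda>i. A i 2) w) (x 1, p, r, s)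
           = (x 1, carry x w p, r, s)"
proof (rule action_word[OF A_family_closed(1) assms, where e = "\<lambda>q. (x 1, q, r, s)"])
  fix i q assume "i \<in> {1..<2::nat}" "inert q"
  then have "i = 1" by auto
  then show "braid_action (A i 2) (x 1, q, r, s) = (x 1, x i \<triangleright> q, r, s)"
    using inert_tri[OF \<open>inert q\<close>, unfolded inert_def]
    by (simp add: A_as_products[unfolded One_nat_def]
      action_sigma action_sigma[unfolded One_nat_def] twist_def)
qed

end

section \<open>The rack of permutations and points\<close>

text \<open>A rack operation must be total, so \<open>Perm f\<close> is admitted for all functions \<open>f\<close>, and those
  that are not bijective act trivially like the points. Conjugation by a bijection respects this
  distinction (\<open>bij_conjugate\<close>), which keeps the operation self-distributive.\<close>

datatype 'a perm_point = Perm "'a \<Rightarrow> 'a" | Point 'a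

fun perm_of :: "'a perm_point \<Rightarrow> 'a \<Rightarrow> 'a"
  where
    "perm_of (Perm f) = (if bij f then f else id)"
  | "perm_of (Point p) = id"

fun transform :: "('a \<Rightarrow> 'a) \<Rightarrow> 'a perm_point \<Rightarrow> 'a perm_point"
  where
    "transform f (Perm g) = Perm (f \<circ> g \<circ> inv_into UNIV f)"
  | "transform f (Point p) = Point (f p)"

lemma bij_perm_of: "bij (perm_of a)"
  by (cases a) auto

lemma transform_comp:
  assumes "bij f" "bij g"
  shows "transform f (transform g c) = transform (f \<circ> g) c"
  using o_inv_distrib[OF assms] by (cases c) (simp_all add: comp_assoc)

lemma transform_id: "transform id c = c"
  by (cases c) simp_all

lemma transform_inverse:
  assumes "bij f"
  shows "transform (inv_into UNIV f) (transform f c) = c"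
    "transform f (transform (inv_into UNIV f) c) = c"
  using assms bij_imp_bij_inv[OF assms]
  by (simp_all add: transform_comp transform_id inv_o_cancel bij_is_inj bij_is_surj
      surj_iff[THEN iffD1])

lemma bij_conjugate:
  assumes "bij f"
  shows "bij (f \<circ> g \<circ> inv_into UNIV f) \<longleftrightarrow> bij g"
proof
  assume b: "bij (f \<circ> g \<circ> inv_into UNIV f)"
  have "g = inv_into UNIV f \<circ> (f \<circ> g \<circ> inv_into UNIV f) \<circ> f"
    using assms by (simp add: fun_eq_iff bij_is_inj)
  then show "bij g" using b assms bij_comp bij_imp_bij_inv by metis
next
  assume "bij g"
  then show "bij (f \<circ> g \<circ> inv_into UNIV f)" using assms bij_comp bij_imp_bij_inv by metis
qed

lemma perm_of_transform:
  assumes "bij f"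
  shows "perm_of (transform f b) \<circ> f = f \<circ> perm_of b"
  using assms by (cases b) (auto simp: bij_conjugate fun_eq_iff bij_is_inj)

interpretation perm_rack: rack "\<lambda>a. transform (perm_of a)"
  "\<lambda>a. transform (inv_into UNIV (perm_of a))"
proof
  fix a b c :: "'a perm_point"
  show "transform (inv_into UNIV (perm_of a)) (transform (perm_of a) b) = b"
    "transform (perm_of a) (transform (inv_into UNIV (perm_of a)) b) = b"
    by (rule transform_inverse[OF bij_perm_of])+
  show "transform (perm_of a) (transform (perm_of b) c)
      = transform (perm_of (transform (perm_of a) b)) (transform (perm_of a) c)"
    by (simp add: transform_comp bij_perm_of perm_of_transform)
qed

lemma inert_Point: "perm_rack.inert (Point p)"
  by (simp add: perm_rack.inert_def transform_id)

text \<open>The reduced words form a regular orbit: this is where a word is read off from its action.\<close>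

lemma carry_push:
  "reduced w \<Longrightarrow>
    perm_rack.carry (\<lambda>i. Perm (push (i, True))) w (Point []) = Point w"
proof (induction w)
  case (Cons l w)
  obtain i b where l: "l = (i, b)" by (cases l)
  have "reduced w" using Cons.prems by (simp add: reduced_Cons)
  then show ?case
    using Cons.IH push_reduced_Cons[OF Cons.prems] l by (cases b) (simp_all add: bij_push inv_push)
qed simp

section \<open>Combed normal forms\<close>

lemma freely_generates_A4: "freely_generates B4 (\<lambda>i. A i 4) {1..<4}"
  unfolding freely_generates_def
proof (intro conjI inj_onI A_family_closed)
  fix v w :: "nat gword"
  assume vw: "v \<in> reduced_words {1..<4}" "w \<in> reduced_words {1..<4}"
    and eq: "word_eval B4 (\<lambda>i. A i 4) v = word_eval B4 (\<lambda>i. A i 4) w"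
  let ?x = "\<lambda>i::nat. Perm (push (i, True))"
  have "perm_rack.braid_action (word_eval B4 (\<lambda>i. A i 4) u) (?x 1, ?x 2, ?x 3, Point [])
          = (?x 1, ?x 2, ?x 3, Point u)" if "u \<in> reduced_words {1..<4}" for u
    using that perm_rack.action_word_A4[OF _ inert_Point, of u ?x "[]"]
    by (simp add: reduced_words_def carry_push)
  from this[OF vw(1)] this[OF vw(2)] show "v = w" by (simp add: eq)
qed

text \<open>The three factors are separated by the number of points in the quadruple. On
  \<open>(x\<^sub>1, p, p, p)\<close> the words in the \<open>A i 4\<close> and the \<open>A i 3\<close> can change only the last two labels, and
  the second label reads off \<open>w2\<close>. The quadruple
  \<open>(x\<^sub>1, x\<^sub>2, p, p)\<close> then shows \<open>w3\<close> in its third place, and freeness leaves \<open>w4 = w\<close>.\<close>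

lemma combed_normal_form_unique:
  assumes w2: "w2 \<in> reduced_words {1..<2}" and w3: "w3 \<in> reduced_words {1..<3}"
    and w4: "w4 \<in> reduced_words {1..<4}" and w: "w \<in> reduced_words {1..<4}"
    and eq: "word_eval B4 (\<lambda>i. A i 2) w2 \<otimes>\<^bsub>B4\<^esub> word_eval B4 (\<lambda>i. A i 3) w3
      \<otimes>\<^bsub>B4\<^esub> word_eval B4 (\<lambda>i. A i 4) w4 = word_eval B4 (\<lambda>i. A i 4) w"
  shows "w2 = [] \<and> w3 = [] \<and> w4 = w"
proof -
  let ?x = "\<lambda>i::nat. Perm (push (i, True))" and ?p = "Point [] :: nat gword perm_point"
  let ?a2 = "word_eval B4 (\<lambda>i. A i 2) w2" and ?a3 = "word_eval B4 (\<lambda>i. A i 3) w3"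
    and ?a4 = "word_eval B4 (\<lambda>i. A i 4) w4" and ?b = "word_eval B4 (\<lambda>i. A i 4) w"
  let ?act = "perm_rack.braid_action"
  have words: "w2 \<in> words {1..<2}" "w3 \<in> words {1..<3}" "w4 \<in> words {1..<4}" "w \<in> words {1..<4}"
    and red: "reduced w2" "reduced w3"
    using w2 w3 w4 w by (simp_all add: reduced_words_def)
  have cl: "?a2 \<in> carrier B4" "?a3 \<in> carrier B4" "?a4 \<in> carrier B4" "?b \<in> carrier B4"
    by (rule B4.word_eval_closed[OF A_family_closed(1) words(1)]
        B4.word_eval_closed[OF A_family_closed(2) words(2)]
        B4.word_eval_closed[OF A_family_closed(3) words(3)]
        B4.word_eval_closed[OF A_family_closed(3) words(4)])+
  have split: "?act ?a2 (?act ?a3 (?act ?a4 s)) = ?act ?b s" for s :: "nat gword perm_point \<times> _"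
    using cl by (simp add: B4.m_assoc flip: eq)
  have x4: "\<exists>q. ?act (word_eval B4 (\<lambda>i. A i 4) u) (a, b, c, ?p) = (a, b, c, q)"
    if "u \<in> words {1..<4}" for u a b c
    using perm_rack.action_word_A4[OF that inert_Point,
        of "\<lambda>i. if i = 1 then a else if i = 2 then b else c"] by simp
  have x3: "\<exists>q. ?act ?a3 (a, b, ?p, r) = (a, b, q, r)" for a b r
    using perm_rack.action_word_A3[OF words(2) inert_Point,
        of "\<lambda>i. if i = 1 then a else b"] by simp
  have "w2 = []"
  proof -
    obtain q4 where 4: "?act ?a4 (?x 1, ?p, ?p, ?p) = (?x 1, ?p, ?p, q4)"
      using x4 words(3) by blast
    obtain q3 where 3: "?act ?a3 (?x 1, ?p, ?p, q4) = (?x 1, ?p, q3, q4)" using x3 by blast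
    obtain q where q: "?act ?b (?x 1, ?p, ?p, ?p) = (?x 1, ?p, ?p, q)" using x4 words(4) by blast
    have "?act ?a2 (?x 1, ?p, q3, q4) = (?x 1, Point w2, q3, q4)"
      using perm_rack.action_word_A2[OF words(1) inert_Point, of ?x] carry_push[OF red(1)] by simp
    then show ?thesis using split[of "(?x 1, ?p, ?p, ?p)"] 4 3 q by simp
  qed
  moreover have "w3 = []"
  proof -
    obtain q4 where 4: "?act ?a4 (?x 1, ?x 2, ?p, ?p) = (?x 1, ?x 2, ?p, q4)"
      using x4 words(3) by blast
    obtain q where q: "?act ?b (?x 1, ?x 2, ?p, ?p) = (?x 1, ?x 2, ?p, q)" using x4 words(4) by blast
    have "?act ?a3 (?x 1, ?x 2, ?p, q4) = (?x 1, ?x 2, Point w3, q4)"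
      using perm_rack.action_word_A3[OF words(2) inert_Point, of ?x] carry_push[OF red(2)] by simp
    then show ?thesis using split[of "(?x 1, ?x 2, ?p, ?p)"] 4 q \<open>w2 = []\<close> by simp
  qed
  moreover have "w4 = w"
  proof -
    have "word_eval B4 (\<lambda>i. A i 4) w4 = word_eval B4 (\<lambda>i. A i 4) w"
      using eq cl \<open>w2 = []\<close> \<open>w3 = []\<close> by simp
    then show ?thesis
      using freely_generates_A4 w4 w unfolding freely_generates_def by (blast dest: inj_onD)
  qed
  ultimately show ?thesis by blast
qed

section \<open>Conjugation of the free subgroup by the first two generators\<close>

lemma group_hom_braid_perm: "group_hom B4 (sym_group 4) braid_perm"
  unfolding B4_def
proof (rule group_hom_presented_group[OF sym_group_is_group])
  show "(\<lambda>i. transpose i (Suc i)) ` {1, 2, 3} \<subseteq> carrier (sym_group 4)"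
    by (auto simp: sym_group_carrier intro!: permutes_swap_id)
qed (rule braid_perm_class)

lemma F4_subgroup: "subgroup (F 4) B4"
  unfolding F_def by (rule B4.generate_is_subgroup[OF A_family_closed(3)])

text \<open>The generators are conjugates of the squares \<open>\<sigma>\<^sub>i\<^sup>2\<close>, whose permutations are trivial.\<close>

lemma F4_subset_P4: "F 4 \<subseteq> P4"
proof -
  interpret h: group_hom B4 "sym_group 4" braid_perm by (rule group_hom_braid_perm)
  have t: "braid_perm (sigma i) = transpose i (Suc i)" if "i \<in> {1, 2, 3}" for i
    using braid_perm_class[of "[(i, True)]"] that by (simp add: sigma_def sym_group_def)
  have sq: "sigma i \<otimes>\<^bsub>B4\<^esub> sigma i \<in> kernel B4 (sym_group 4) braid_perm" if "i \<in> {1, 2, 3}" for i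
    using that sigma_closed[OF that] by (auto simp: kernel_def t sym_group_def)
  note conj = normal.inv_op_closed2[OF h.normal_kernel]
  have "A 1 4 \<in> P4" "A 2 4 \<in> P4" "A 3 4 \<in> P4"
    using sq[of 3] conj[OF _ sq[of 2], of "sigma 3"]
      conj[OF _ conj[OF _ sq[of 1], of "sigma 2"], of "sigma 3"]
    by (simp_all add: P4_def A_products B4.m_assoc)
  moreover have "{1..<4} = {1, 2, 3::nat}" by auto
  ultimately have "(\<lambda>i. A i 4) ` {1..<4} \<subseteq> kernel B4 (sym_group 4) braid_perm"
    by (simp only: P4_def image_insert image_empty insert_subset empty_subsetI simp_thms)
  then show ?thesis
    unfolding F_def P4_def by (rule B4.generate_subgroup_incl[OF _ h.subgroup_kernel])
qed

lemma (in group) cancel_inv_left: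
  "x \<in> carrier G \<Longrightarrow> y \<in> carrier G \<Longrightarrow> x \<otimes> (inv x \<otimes> y) = y"
  "x \<in> carrier G \<Longrightarrow> y \<in> carrier G \<Longrightarrow> inv x \<otimes> (x \<otimes> y) = y"
  by (simp_all flip: m_assoc)

lemma (in group) conjugate_mem_generate:
  assumes "f ` S \<subseteq> carrier G" "s \<in> carrier G"
    and "\<And>i. i \<in> S \<Longrightarrow> s \<otimes> f i \<otimes> inv s \<in> generate G (f ` S)"
    and "y \<in> generate G (f ` S)"
  shows "s \<otimes> y \<otimes> inv s \<in> generate G (f ` S)"
  using assms(4)
proof (induction rule: generate.induct)
  case one
  then show ?case using assms(2) by (simp add: generate.one)
next
  case (incl h)
  then show ?case using assms(3) by blast
next
  case (inv h)
  then have h: "h \<in> carrier G" "s \<otimes> h \<otimes> inv s \<in> generate G (f ` S)" using assms by auto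
  have "s \<otimes> inv h \<otimes> inv s = inv (s \<otimes> h \<otimes> inv s)"
    using h assms(2) by (simp add: inv_mult_group m_assoc)
  then show ?case using generate_m_inv_closed[OF assms(1) h(2)] by simp
next
  case (eng h1 h2)
  then have h: "h1 \<in> carrier G" "h2 \<in> carrier G"
    using generate_in_carrier[OF assms(1)] by auto
  have "s \<otimes> (h1 \<otimes> h2) \<otimes> inv s = (s \<otimes> h1 \<otimes> inv s) \<otimes> (s \<otimes> h2 \<otimes> inv s)"
    using h assms(2) by (simp add: m_assoc cancel_inv_left)
  then show ?case using eng generate.eng by metis
qed

lemma (in group) conj_of_commute:
  assumes "s \<in> carrier G" "x \<in> carrier G" "y \<in> carrier G" "s \<otimes> x = y \<otimes> s"
  shows "s \<otimes> x \<otimes> inv s = y" "inv s \<otimes> y \<otimes> s = x"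
proof -
  show "s \<otimes> x \<otimes> inv s = y" using assms by (simp add: m_assoc)
  show "inv s \<otimes> y \<otimes> s = x" using assms(1-3) by (simp add: m_assoc cancel_inv_left flip: assms(4))
qed

text \<open>If \<open>s\<close> conjugates \<open>x\<close> to \<open>y\<close> and commutes with \<open>x y\<close>, then the remaining conjugates are words in
  \<open>x\<close> and \<open>y\<close> too. This is how a braid generator acts on the two loops that it exchanges.\<close>

lemma (in group) conj_of_commute_product:
  assumes c: "s \<in> carrier G" "x \<in> carrier G" "y \<in> carrier G"
    and xy: "s \<otimes> x = y \<otimes> s" and comm: "s \<otimes> (x \<otimes> y) = (x \<otimes> y) \<otimes> s"
  shows "s \<otimes> y \<otimes> inv s = inv y \<otimes> x \<otimes> y" "inv s \<otimes> x \<otimes> s = x \<otimes> y \<otimes> inv x"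
proof -
  have "y \<otimes> (s \<otimes> y) = x \<otimes> y \<otimes> s"
    using xy comm c by (simp add: m_assoc[symmetric])
  then have "s \<otimes> y = inv y \<otimes> x \<otimes> y \<otimes> s"
    using c by (simp add: m_assoc inv_solve_left)
  then show "s \<otimes> y \<otimes> inv s = inv y \<otimes> x \<otimes> y"
    using c by (intro conj_of_commute) auto
  have "s \<otimes> (x \<otimes> y \<otimes> inv x) = s \<otimes> (x \<otimes> y) \<otimes> inv x"
    using c by (simp add: m_assoc)
  also have "\<dots> = x \<otimes> (y \<otimes> s) \<otimes> inv x"
    using c by (simp add: comm m_assoc)
  also have "\<dots> = x \<otimes> s"
    using c by (simp add: m_assoc flip: xy)
  finally have "s \<otimes> (x \<otimes> y \<otimes> inv x) = x \<otimes> s" .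
  then show "inv s \<otimes> x \<otimes> s = x \<otimes> y \<otimes> inv x"
    using c by (intro conj_of_commute) auto
qed

lemma (in group) braid_relation_assoc:
  assumes "a \<in> carrier G" "b \<in> carrier G" "z \<in> carrier G" "a \<otimes> (b \<otimes> a) = b \<otimes> (a \<otimes> b)"
  shows "a \<otimes> (b \<otimes> (a \<otimes> z)) = b \<otimes> (a \<otimes> (b \<otimes> z))"
proof -
  have "a \<otimes> (b \<otimes> (a \<otimes> z)) = (a \<otimes> (b \<otimes> a)) \<otimes> z" using assms(1-3) by (simp add: m_assoc)
  also have "\<dots> = b \<otimes> (a \<otimes> (b \<otimes> z))" using assms(1-3) by (simp add: assms(4) m_assoc)
  finally show ?thesis .
qed

lemma (in group) commute_assoc:
  assumes "a \<in> carrier G" "b \<in> carrier G" "z \<in> carrier G" "a \<otimes> b = b \<otimes> a"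
  shows "a \<otimes> (b \<otimes> z) = b \<otimes> (a \<otimes> z)"
  using assms by (metis m_assoc)

lemma (in group) commute_inv:
  assumes "a \<in> carrier G" "b \<in> carrier G" "a \<otimes> b = b \<otimes> a"
  shows "inv b \<otimes> a = a \<otimes> inv b"
  using assms by (metis inv_closed inv_solve_left inv_solve_right m_assoc m_closed)

lemma (in group) braid_relation_inv:
  assumes "b \<in> carrier G" "c \<in> carrier G" "b \<otimes> (c \<otimes> b) = c \<otimes> (b \<otimes> c)"
  shows "c \<otimes> (inv b \<otimes> inv c) = inv b \<otimes> (inv c \<otimes> b)"
proof -
  have "(c \<otimes> b) \<otimes> (c \<otimes> (inv b \<otimes> inv c)) = b \<otimes> (c \<otimes> (b \<otimes> (inv b \<otimes> inv c)))"
    using assms braid_relation_assoc[of b c "inv b \<otimes> inv c"] by (simp add: m_assoc)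
  also have "\<dots> = b" using assms(1,2) by (simp add: cancel_inv_left)
  also have "b = (c \<otimes> b) \<otimes> (inv b \<otimes> (inv c \<otimes> b))"
    using assms(1,2) by (simp add: cancel_inv_left m_assoc)
  finally show ?thesis using assms(1,2) by (simp del: m_assoc)
qed

text \<open>The generator \<open>\<sigma>\<^sub>i\<close> exchanges strands \<open>i\<close> and \<open>i + 1\<close>: it takes the loop of the last strand
  around one to the loop around the other, keeps the loop around both, and does not affect the
  remaining one. Each equation is verified by moving the letter on the left through the word with
  the braid relations.\<close>

lemma sigma_A4_commutations:
  "sigma 1 \<otimes>\<^bsub>B4\<^esub> A 1 4 = A 2 4 \<otimes>\<^bsub>B4\<^esub> sigma 1"
  "sigma 1 \<otimes>\<^bsub>B4\<^esub> (A 1 4 \<otimes>\<^bsub>B4\<^esub> A 2 4) = (A 1 4 \<otimes>\<^bsub>B4\<^esub> A 2 4) \<otimes>\<^bsub>B4\<^esub> sigma 1"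
  "sigma 1 \<otimes>\<^bsub>B4\<^esub> A 3 4 = A 3 4 \<otimes>\<^bsub>B4\<^esub> sigma 1"
  "sigma 2 \<otimes>\<^bsub>B4\<^esub> A 2 4 = A 3 4 \<otimes>\<^bsub>B4\<^esub> sigma 2"
  "sigma 2 \<otimes>\<^bsub>B4\<^esub> (A 2 4 \<otimes>\<^bsub>B4\<^esub> A 3 4) = (A 2 4 \<otimes>\<^bsub>B4\<^esub> A 3 4) \<otimes>\<^bsub>B4\<^esub> sigma 2"
  "sigma 2 \<otimes>\<^bsub>B4\<^esub> A 1 4 = A 1 4 \<otimes>\<^bsub>B4\<^esub> sigma 2"
proof -
  define a b c where "a = sigma 1" and "b = sigma 2" and "c = sigma 3"
  have cl [simp]: "a \<in> carrier B4" "b \<in> carrier B4" "c \<in> carrier B4"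
    by (simp_all add: a_def b_def c_def)
  have ab: "a \<otimes>\<^bsub>B4\<^esub> (b \<otimes>\<^bsub>B4\<^esub> a) = b \<otimes>\<^bsub>B4\<^esub> (a \<otimes>\<^bsub>B4\<^esub> b)"
    and bc: "b \<otimes>\<^bsub>B4\<^esub> (c \<otimes>\<^bsub>B4\<^esub> b) = c \<otimes>\<^bsub>B4\<^esub> (b \<otimes>\<^bsub>B4\<^esub> c)"
    and ac: "a \<otimes>\<^bsub>B4\<^esub> c = c \<otimes>\<^bsub>B4\<^esub> a"
    using sigma_braid_12 sigma_braid_23 sigma_commute_13 by (simp_all only: a_def b_def c_def)
  note ab' = B4.braid_relation_assoc[OF cl(1,2) _ ab] and bc' = B4.braid_relation_assoc[OF cl(2,3) _ bc]
    and ac' = B4.commute_assoc[OF cl(1,3) _ ac] and ca' = B4.commute_assoc[OF cl(3,1) _ ac[symmetric]]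
    and ac_inv = B4.commute_inv[OF cl(1,3) ac] and bc_inv = B4.braid_relation_inv[OF cl(2,3) bc]
  note A = A_as_products[folded a_def b_def c_def]
  note assoc = B4.m_assoc B4.cancel_inv_left
  show "sigma 1 \<otimes>\<^bsub>B4\<^esub> A 1 4 = A 2 4 \<otimes>\<^bsub>B4\<^esub> sigma 1"
    unfolding A a_def[symmetric] by (simp add: assoc ac' ab' ac_inv)
  show "sigma 1 \<otimes>\<^bsub>B4\<^esub> (A 1 4 \<otimes>\<^bsub>B4\<^esub> A 2 4) = (A 1 4 \<otimes>\<^bsub>B4\<^esub> A 2 4) \<otimes>\<^bsub>B4\<^esub> sigma 1"
    unfolding A a_def[symmetric] by (simp add: assoc ac' ab' ac_inv)
  show "sigma 1 \<otimes>\<^bsub>B4\<^esub> A 3 4 = A 3 4 \<otimes>\<^bsub>B4\<^esub> sigma 1"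
    unfolding A a_def[symmetric] by (simp add: assoc ac' ac)
  show "sigma 2 \<otimes>\<^bsub>B4\<^esub> A 2 4 = A 3 4 \<otimes>\<^bsub>B4\<^esub> sigma 2"
    unfolding A b_def[symmetric] by (simp add: assoc bc')
  show "sigma 2 \<otimes>\<^bsub>B4\<^esub> (A 2 4 \<otimes>\<^bsub>B4\<^esub> A 3 4) = (A 2 4 \<otimes>\<^bsub>B4\<^esub> A 3 4) \<otimes>\<^bsub>B4\<^esub> sigma 2"
    unfolding A b_def[symmetric] by (simp add: assoc bc' bc)
  show "sigma 2 \<otimes>\<^bsub>B4\<^esub> A 1 4 = A 1 4 \<otimes>\<^bsub>B4\<^esub> sigma 2"
    unfolding A b_def[symmetric] by (simp add: assoc bc' ca' bc_inv)
qed

lemma A4_in_F4: "A 1 4 \<in> F 4" "A 2 4 \<in> F 4" "A 3 4 \<in> F 4"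
  by (auto simp: F_def intro!: generate.incl)

text \<open>The signs are those in the inverse of \<open>A\<^sub>1\<^sub>2\<^sup>-\<^sup>1 A\<^sub>2\<^sub>3 = \<sigma>\<^sub>1\<^sup>-\<^sup>2 \<sigma>\<^sub>2\<^sup>2\<close>, which
  conjugates \<open>A 3 4\<close> in \<open>\<beta> m\<close>.\<close>

lemma F4_conjugation:
  assumes "y \<in> F 4"
  shows "sigma 1 \<otimes>\<^bsub>B4\<^esub> y \<otimes>\<^bsub>B4\<^esub> inv\<^bsub>B4\<^esub> sigma 1 \<in> F 4"
    "inv\<^bsub>B4\<^esub> sigma 2 \<otimes>\<^bsub>B4\<^esub> y \<otimes>\<^bsub>B4\<^esub> sigma 2 \<in> F 4"
proof -
  note F = subgroup.m_closed[OF F4_subgroup] subgroup.m_inv_closed[OF F4_subgroup] A4_in_F4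
  have range: "i = 1 \<or> i = 2 \<or> i = 3" if "i \<in> {1..<4}" for i :: nat using that by auto
  note cl = A_closed sigma_closed_each[folded One_nat_def]
  have 1: "sigma 1 \<otimes>\<^bsub>B4\<^esub> A i 4 \<otimes>\<^bsub>B4\<^esub> inv\<^bsub>B4\<^esub> sigma 1 \<in> F 4" if "i \<in> {1..<4}" for i
    using range[OF that]
  proof (elim disjE)
    assume "i = 1"
    then show ?thesis
      using B4.conj_of_commute(1)[OF cl(7,4,5) sigma_A4_commutations(1)] F by metis
  next
    assume "i = 2"
    then show ?thesis
      using B4.conj_of_commute_product(1)[OF cl(7,4,5) sigma_A4_commutations(1,2)] F by metis
  next
    assume "i = 3"
    then show ?thesis
      using B4.conj_of_commute(1)[OF cl(7,6,6) sigma_A4_commutations(3)] F by metis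
  qed
  have 2: "inv\<^bsub>B4\<^esub> sigma 2 \<otimes>\<^bsub>B4\<^esub> A i 4 \<otimes>\<^bsub>B4\<^esub> sigma 2 \<in> F 4" if "i \<in> {1..<4}" for i
    using range[OF that]
  proof (elim disjE)
    assume "i = 1"
    then show ?thesis
      using B4.conj_of_commute(2)[OF cl(8,4,4) sigma_A4_commutations(6)] F by metis
  next
    assume "i = 2"
    then show ?thesis
      using B4.conj_of_commute_product(2)[OF cl(8,5,6) sigma_A4_commutations(4,5)] F by metis
  next
    assume "i = 3"
    then show ?thesis
      using B4.conj_of_commute(2)[OF cl(8,5,6) sigma_A4_commutations(4)] F by metis
  qed
  show "sigma 1 \<otimes>\<^bsub>B4\<^esub> y \<otimes>\<^bsub>B4\<^esub> inv\<^bsub>B4\<^esub> sigma 1 \<in> F 4"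
    using B4.conjugate_mem_generate[OF A_family_closed(3) cl(7)] 1 assms unfolding F_def by blast
  show "inv\<^bsub>B4\<^esub> sigma 2 \<otimes>\<^bsub>B4\<^esub> y \<otimes>\<^bsub>B4\<^esub> sigma 2 \<in> F 4"
    using B4.conjugate_mem_generate[OF A_family_closed(3) B4.inv_closed[OF cl(8)]] 2 assms
    unfolding F_def B4.inv_inv[OF cl(8)] by blast
qed

definition conjugator :: "nat gword set"
  where "conjugator = inv\<^bsub>B4\<^esub> A 1 2 \<otimes>\<^bsub>B4\<^esub> A 2 3"

lemma conjugator_closed: "conjugator \<in> carrier B4"
  using A_closed by (simp add: conjugator_def)

lemma \<beta>_eq: "\<beta> m = inv\<^bsub>B4\<^esub> (conjugator [^]\<^bsub>B4\<^esub> m) \<otimes>\<^bsub>B4\<^esub> A 3 4 \<otimes>\<^bsub>B4\<^esub> (conjugator [^]\<^bsub>B4\<^esub> m)"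
  using B4.int_pow_neg[OF conjugator_closed, of "int m"] by (simp add: \<beta>_def int_pow_int conjugator_def)

lemma conjugator_conjugation:
  assumes "y \<in> F 4"
  shows "inv\<^bsub>B4\<^esub> conjugator \<otimes>\<^bsub>B4\<^esub> y \<otimes>\<^bsub>B4\<^esub> conjugator \<in> F 4"
proof -
  let ?s = "sigma 1" and ?t = "sigma 2"
  have y: "y \<in> carrier B4" using assms subgroup.mem_carrier[OF F4_subgroup] by blast
  have "inv\<^bsub>B4\<^esub> ?t \<otimes>\<^bsub>B4\<^esub> (inv\<^bsub>B4\<^esub> ?t \<otimes>\<^bsub>B4\<^esub> (?s \<otimes>\<^bsub>B4\<^esub> (?s \<otimes>\<^bsub>B4\<^esub> y \<otimes>\<^bsub>B4\<^esub> inv\<^bsub>B4\<^esub> ?s)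
      \<otimes>\<^bsub>B4\<^esub> inv\<^bsub>B4\<^esub> ?s) \<otimes>\<^bsub>B4\<^esub> ?t) \<otimes>\<^bsub>B4\<^esub> ?t \<in> F 4"
    by (intro F4_conjugation assms)
  then show ?thesis
    using y by (simp add: conjugator_def A_products B4.inv_mult_group
        B4.m_assoc)
qed

lemma \<beta>_in_F4: "\<beta> m \<in> F 4"
proof (induction m)
  case 0
  then show ?case using A_closed A4_in_F4 by (simp add: \<beta>_eq)
next
  case (Suc m)
  have "\<beta> (Suc m) = inv\<^bsub>B4\<^esub> conjugator \<otimes>\<^bsub>B4\<^esub> \<beta> m \<otimes>\<^bsub>B4\<^esub> conjugator"
    using A_closed conjugator_closed unfolding \<beta>_eq by (simp add: B4.inv_mult_group B4.m_assoc)
  then show ?case using conjugator_conjugation[OF Suc.IH] by simp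
qed

section \<open>Exponential growth\<close>

definition reflect :: "int \<Rightarrow> int \<Rightarrow> int"
  where "reflect c p = 2 * c - p"

lemma bij_reflect [simp]: "bij (reflect c)"
  by (rule o_bij[of "reflect c"]) (auto simp: reflect_def fun_eq_iff)

lemma inv_reflect [simp]: "inv_into UNIV (reflect c) = reflect c"
  by (rule inv_unique_comp) (auto simp: reflect_def fun_eq_iff)

lemma reflect_comp [simp]: "reflect c \<circ> reflect d \<circ> reflect c = reflect (2 * c - d)"
  by (auto simp: reflect_def fun_eq_iff)

text \<open>Conjugating the reflection in \<open>d\<close> by the reflection in \<open>c\<close> gives the reflection in \<open>2 c - d\<close>,
  so a braid acts linearly on the centres; this is a form of the Burau representation at
  \<open>t = -1\<close>.\<close>

lemma conjugator_action:
  "perm_rack.braid_action conjugator (Perm (reflect c1), Perm (reflect c2), Perm (reflect c3), q)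
     = (Perm (reflect (6 * c2 - 4 * c3 - c1)), Perm (reflect (9 * c2 - 6 * c3 - 2 * c1)),
        Perm (reflect (2 * c2 - c3)), q)"
  by (simp add: conjugator_def A_products B4.inv_mult_group
      perm_rack.action_sigma perm_rack.action_inv_sigma perm_rack.twist_def
      perm_rack.untwist_def perm_rack.action_sigma[unfolded One_nat_def]
      perm_rack.action_inv_sigma[unfolded One_nat_def])
    (simp add: algebra_simps)

text \<open>With \<open>a = c1 - c2\<close> and \<open>b = c3 - c2\<close>, one application of the conjugator replaces \<open>(a, b)\<close> by
  \<open>(a + 2 b, 2 a + 5 b)\<close> and \<open>c3\<close> by \<open>c3 - 2 b\<close>. Starting at \<open>(0, 1)\<close>, both stay nonnegative, so
  that \<open>b\<close> is multiplied by at least \<open>5\<close>, and \<open>c3\<close> decreases accordingly; the bound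
  \<open>(3 - 5 ^ m) / 2\<close> for it is the sum of a geometric series.\<close>

lemma conjugator_power_action:
  "\<exists>c1 c2 c3. (\<forall>q. perm_rack.braid_action (conjugator [^]\<^bsub>B4\<^esub> m)
        (Perm (reflect 0), Perm (reflect 0), Perm (reflect 1), q)
      = (Perm (reflect c1), Perm (reflect c2), Perm (reflect c3), q))
    \<and> c2 \<le> c1 \<and> 5 ^ m \<le> c3 - c2 \<and> 2 * c3 \<le> 3 - 5 ^ m"
proof (induction m)
  case 0
  then show ?case by (intro exI[of _ 0] exI[of _ 1]) simp
next
  case (Suc m)
  then obtain c1 c2 c3 where c: "\<And>q. perm_rack.braid_action (conjugator [^]\<^bsub>B4\<^esub> m)
        (Perm (reflect 0), Perm (reflect 0), Perm (reflect 1), q)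
      = (Perm (reflect c1), Perm (reflect c2), Perm (reflect c3), q)"
    and ineq: "c2 \<le> c1" "5 ^ m \<le> c3 - c2" "2 * c3 \<le> 3 - 5 ^ m" by blast
  have "perm_rack.braid_action (conjugator [^]\<^bsub>B4\<^esub> Suc m)
        (Perm (reflect 0), Perm (reflect 0), Perm (reflect 1), q)
      = (Perm (reflect (6 * c2 - 4 * c3 - c1)), Perm (reflect (9 * c2 - 6 * c3 - 2 * c1)),
        Perm (reflect (2 * c2 - c3)), q)" for q
    by (simp only: B4.nat_pow_Suc2[OF conjugator_closed] c conjugator_action
        perm_rack.action_mult[OF conjugator_closed B4.nat_pow_closed[OF conjugator_closed]])
  moreover have "9 * c2 - 6 * c3 - 2 * c1 \<le> 6 * c2 - 4 * c3 - c1"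
    using ineq zero_le_power[of "5::int" m] by linarith
  moreover have "5 ^ Suc m \<le> (2 * c2 - c3) - (9 * c2 - 6 * c3 - 2 * c1)"
    using ineq by simp
  moreover have "2 * (2 * c2 - c3) \<le> 3 - 5 ^ Suc m"
    using ineq by simp
  ultimately show ?case by blast
qed

text \<open>The power of the conjugator that acts first moves the centres, \<open>A 3 4\<close> reflects the point in the
  new third centre, and the inverse power restores the centres without touching the point.\<close>

lemma \<beta>_action:
  "\<exists>c. 2 * c \<le> 3 - 5 ^ m \<and>
    perm_rack.braid_action (\<beta> m) (Perm (reflect 0), Perm (reflect 0), Perm (reflect 1), Point 0)
      = (Perm (reflect 0), Perm (reflect 0), Perm (reflect 1), Point (2 * c))"
proof -
  let ?act = "perm_rack.braid_action" and ?g = "conjugator [^]\<^bsub>B4\<^esub> m"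
    and ?s = "\<lambda>q. (Perm (reflect 0), Perm (reflect 0), Perm (reflect 1), q)"
  obtain c1 c2 c3 where c: "\<And>q. ?act ?g (?s q)
      = (Perm (reflect c1), Perm (reflect c2), Perm (reflect c3), q)"
    and c3: "2 * c3 \<le> 3 - 5 ^ m"
    using conjugator_power_action[of m] by blast
  have cl: "?g \<in> carrier B4" using conjugator_closed by simp
  have "?act (A 3 4) (Perm (reflect c1), Perm (reflect c2), Perm (reflect c3), Point 0)
      = ?act ?g (?s (Point (2 * c3)))"
    by (simp only: c A_as_products)
      (simp add: perm_rack.action_sigma perm_rack.twist_def transform_id reflect_def)
  moreover have inv_g: "?act (inv\<^bsub>B4\<^esub> ?g) (Perm (reflect c1), Perm (reflect c2), Perm (reflect c3), q)
      = ?s q" for q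
    using perm_rack.action_inv_action[OF cl, of "?s q"] by (simp only: c)
  ultimately have "?act (\<beta> m) (?s (Point 0)) = ?s (Point (2 * c3))"
    unfolding \<beta>_eq using cl A_closed(6) by (simp add: c inv_g)
  then show ?thesis using c3 by blast
qed

text \<open>A letter \<open>1\<close> or \<open>2\<close> only changes the sign of an integer, and a letter \<open>3\<close> adds at most \<open>2\<close> to
  its absolute value.\<close>

lemma carry_reflect_bound:
  fixes x :: "nat \<Rightarrow> int perm_point"
  assumes "x = (\<lambda>i. Perm (reflect (if i = 3 then 1 else 0)))"
  shows "\<exists>q. perm_rack.carry x w (Point 0) = Point q \<and> \<bar>q\<bar> \<le> 2 * int (length w)"
proof (induction w)
  case (Cons l w)
  then obtain q where q: "perm_rack.carry x w (Point 0) = Point q" "\<bar>q\<bar> \<le> 2 * int (length w)"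
    by blast
  obtain i b where "l = (i, b)" by (cases l)
  then show ?case
    using q by (cases b) (auto simp: assms reflect_def)
qed simp

lemma \<beta>_combed_normal_form:
  assumes m: "m \<ge> 1"
  shows "\<beta> m \<in> P4 \<and> \<beta> m \<in> F 4 \<and>
    (\<exists>w. (\<forall>v. is_combed_normal_form (\<beta> m) v \<longleftrightarrow> v = ([], [], w)) \<and>
         real (length w) \<ge> 1 / 5 * 5 ^ m)"
proof -
  have F: "\<beta> m \<in> F 4" by (rule \<beta>_in_F4)
  then have P: "\<beta> m \<in> P4" using F4_subset_P4 by blast
  obtain w where w: "w \<in> reduced_words {1..<4}" "word_eval B4 (\<lambda>i. A i 4) w = \<beta> m"
    using B4.reduced_word_of_generate[OF A_family_closed(3)] F unfolding F_def by blast
  have cl: "\<beta> m \<in> carrier B4" using F subgroup.mem_carrier[OF F4_subgroup] by blast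
  have combed: "is_combed_normal_form (\<beta> m) v \<longleftrightarrow> v = ([], [], w)" for v
  proof
    assume "is_combed_normal_form (\<beta> m) v"
    then show "v = ([], [], w)"
      using combed_normal_form_unique[OF _ _ _ w(1)] w(2)
      by (cases v) (auto simp: is_combed_normal_form_def)
  next
    assume "v = ([], [], w)"
    then show "is_combed_normal_form (\<beta> m) v"
      using P w cl by (simp add: is_combed_normal_form_def reduced_words_def)
  qed
  have long: "real (length w) \<ge> 1 / 5 * 5 ^ m"
  proof -
    define x where "x = (\<lambda>i::nat. Perm (reflect (if i = 3 then 1 else 0)))"
    obtain q where q: "perm_rack.carry x w (Point 0) = Point q" "\<bar>q\<bar> \<le> 2 * int (length w)"
      using carry_reflect_bound[OF x_def] by blast
    obtain c where c: "2 * c \<le> 3 - 5 ^ m"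
      "perm_rack.braid_action (\<beta> m) (x 1, x 2, x 3, Point 0) = (x 1, x 2, x 3, Point (2 * c))"
      using \<beta>_action[of m] by (auto simp: x_def)
    have "w \<in> words {1..<4}" using w(1) by (simp add: reduced_words_def)
    from perm_rack.action_word_A4[OF this inert_Point, of x 0]
    have "q = 2 * c" using q(1) c(2) w(2) by simp
    then have "5 ^ m - 3 \<le> 2 * int (length w)" using q(2) c(1) by linarith
    then have "real_of_int (5 ^ m - 3) \<le> real_of_int (2 * int (length w))"
      by (simp only: of_int_le_iff)
    \<comment> \<open>For \<open>m \<ge> 1\<close> the error term \<open>3\<close> is at most \<open>3 / 5 * 5 ^ m\<close>, which leaves \<open>(1 - 3 / 5) / 2 = 1 / 5\<close>.\<close>
    moreover have "(5::real) ^ 1 \<le> 5 ^ m" using m by (intro power_increasing) auto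
    ultimately show ?thesis by simp
  qed
  have ex: "\<exists>w. (\<forall>v. is_combed_normal_form (\<beta> m) v \<longleftrightarrow> v = ([], [], w)) \<and>
      real (length w) \<ge> 1 / 5 * 5 ^ m"
    by (intro exI[of _ w] conjI allI combed long)
  show ?thesis using P F ex by (intro conjI)
qed

theorem lemma3p6:
  shows "freely_generates B4 (\<lambda>i. A i 4) {1..<4} \<and>
    (\<exists>C::real. \<exists>l::real. C > 0 \<and> l > 1 \<and>
      (\<forall>m::nat. m \<ge> 1 \<longrightarrow>
        \<beta> m \<in> P4 \<and> \<beta> m \<in> F 4 \<and>
        (\<exists>w. (\<forall>v. is_combed_normal_form (\<beta> m) v \<longleftrightarrow> v = ([], [], w)) \<and>
             real (length w) \<ge> C * l ^ m)))"
proof (intro conjI freely_generates_A4)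
  show "\<exists>C::real. \<exists>l::real. C > 0 \<and> l > 1 \<and>
      (\<forall>m::nat. m \<ge> 1 \<longrightarrow>
        \<beta> m \<in> P4 \<and> \<beta> m \<in> F 4 \<and>
        (\<exists>w. (\<forall>v. is_combed_normal_form (\<beta> m) v \<longleftrightarrow> v = ([], [], w)) \<and>
             real (length w) \<ge> C * l ^ m))"
  proof (rule exI[of _ "1 / 5"], rule exI[of _ 5], intro conjI)
    show "(0::real) < 1 / 5" by simp
    show "(1::real) < 5" by simp
    show "\<forall>m::nat. m \<ge> 1 \<longrightarrow>
        \<beta> m \<in> P4 \<and> \<beta> m \<in> F 4 \<and>
        (\<exists>w. (\<forall>v. is_combed_normal_form (\<beta> m) v \<longleftrightarrow> v = ([], [], w)) \<and>
             real (length w) \<ge> 1 / 5 * 5 ^ m)"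
      by (intro allI impI) (rule \<beta>_combed_normal_form)
  qed
qed

end
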